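(* For every real $P>0$ and $C>0$ there is $M=M(P,C)$ such that every graph $G$ with $$\chi(G)\ge M,\qquad e(G)\le C\,\chi(G)^P$$ contains a subgraph of girth at least $5$ and chromatic number at least $4$. In particular, every triangle-free graph $G$ of sufficiently high chromatic number (depending on $P,C$) satisfying $e(G)\le C\chi(G)^P$ contains a $C_4$-free $4$-chromatic subgraph.
   Context: All graphs are finite and simple; subgraphs need not be induced. $\chi$ is the chromatic number, $e(G)$ the number of edges. The girth of a forest is $\infty$. $C_4$-free means containing no cycle of length $4$. *)

theory Defs
  imports Complex_Main "HOL-Library.Extended_Nat"
begin

type_synonym 'a sgraph = "'a set \<times> 'a set set"

definition verts :: "'a sgraph \<Rightarrow> 'a set" where
  "verts G = fst G"

definition edges :: "'a sgraph \<Rightarrow> 'a set set" where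
  "edges G = snd G"

definition simple_graph :: "'a sgraph \<Rightarrow> bool" where
  "simple_graph G \<longleftrightarrow> finite (verts G) \<and> (\<forall>e\<in>edges G. e \<subseteq> verts G \<and> card e = 2)"

definition subgraph :: "'a sgraph \<Rightarrow> 'a sgraph \<Rightarrow> bool" where
  "subgraph H G \<longleftrightarrow> simple_graph H \<and> verts H \<subseteq> verts G \<and> edges H \<subseteq> edges G"

definition proper_colouring :: "'a sgraph \<Rightarrow> nat \<Rightarrow> ('a \<Rightarrow> nat) \<Rightarrow> bool" where
  "proper_colouring G k f \<longleftrightarrow>
     (\<forall>v\<in>verts G. f v < k) \<and> (\<forall>u v. {u, v} \<in> edges G \<longrightarrow> f u \<noteq> f v)"

(* For a simple graph in the sense above some k always admits a colouring. *)
definition chromatic_number :: "'a sgraph \<Rightarrow> nat" where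
  "chromatic_number G = (LEAST k. \<exists>f. proper_colouring G k f)"

(* A cycle is listed by its vertices, without repeating the first one at the end. *)
definition cycle :: "'a sgraph \<Rightarrow> 'a list \<Rightarrow> bool" where
  "cycle G vs \<longleftrightarrow>
     length vs \<ge> 3 \<and> distinct vs \<and> set vs \<subseteq> verts G \<and>
     (\<forall>i. Suc i < length vs \<longrightarrow> {vs ! i, vs ! Suc i} \<in> edges G) \<and>
     {last vs, hd vs} \<in> edges G"

(* The infimum of the empty set in enat is \<infinity>, the girth of a forest. *)
definition girth :: "'a sgraph \<Rightarrow> enat" where
  "girth G = (INF vs\<in>{vs. cycle G vs}. enat (length vs))"

definition triangle_free :: "'a sgraph \<Rightarrow> bool" where
  "triangle_free G \<longleftrightarrow> \<not> (\<exists>vs. cycle G vs \<and> length vs = 3)"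

definition C4_free :: "'a sgraph \<Rightarrow> bool" where
  "C4_free G \<longleftrightarrow> \<not> (\<exists>vs. cycle G vs \<and> length vs = 4)"

end

theory Submission
  imports Defs "HOL-Real_Asymp.Real_Asymp"
begin

text \<open>
  Write \<open>x\<close> for the chromatic number. Greedy colouring yields a vertex set \<open>X\<close> all of whose
  independent subsets have size at most \<open>x powr (-1/2) * card X\<close>; this property passes, up to a
  factor \<open>6\<close>, to every subset containing a sixth of \<open>X\<close>, and by Turan's bound it forces the edge
  density \<open>a\<close> (edges per vertex) to be at least about \<open>x powr (1/2)\<close>. Discard the vertices of
  degree above \<open>4 * a\<close>. If every third of the remaining set has density at least about \<open>a / q\<close>,
  where \<open>q = x powr (1/10)\<close>, then keeping each edge with probability \<open>q / a\<close> leaves, in every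
  third, more edges than there are cycles of length \<open>3\<close> or \<open>4\<close> in total; deleting an edge of each
  such cycle therefore leaves a graph of girth at least \<open>5\<close> in which no third is independent, so it
  is not 3-colourable. Otherwise some third has density smaller by a factor of order \<open>q\<close>, and one
  continues there. The initial density is polynomial in \<open>x\<close>, so boundedly many such decrements
  contradict the lower bound on the density.
\<close>

section \<open>Induced edge sets, neighbourhoods, densities, walks and edge sets of cycles\<close>

definition edges_in :: "'a set set \<Rightarrow> 'a set \<Rightarrow> 'a set set" where
  "edges_in E X = {e\<in>E. e \<subseteq> X}"

definition nbrs :: "'a set set \<Rightarrow> 'a \<Rightarrow> 'a set" where
  "nbrs E v = {u. {u, v} \<in> E}"

definition edge_density :: "'a sgraph \<Rightarrow> 'a set \<Rightarrow> real" where
  "edge_density G X = card (edges_in (edges G) X) / card X"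

text \<open>The index \<open>k\<close> counts edges, so the lists have \<open>Suc k\<close> entries.
  Vertices may repeat, which lets walks be counted by free extension and still covers every cycle
  listing.\<close>

definition walks :: "'a set \<Rightarrow> 'a set set \<Rightarrow> nat \<Rightarrow> 'a list set" where
  "walks V E k = {vs. length vs = Suc k \<and> set vs \<subseteq> V \<and>
     (\<forall>i. Suc i < length vs \<longrightarrow> {vs ! i, vs ! Suc i} \<in> E)}"

definition cycle_edges :: "'a list \<Rightarrow> 'a set set" where
  "cycle_edges vs = insert {last vs, hd vs} ((\<lambda>i. {vs ! i, vs ! Suc i}) ` {i. Suc i < length vs})"

lemma verts_edges_simps [simp]: "verts (V, E) = V" "edges (V, E) = E"
  by (simp_all add: verts_def edges_def)

lemma simple_graph_finite_edges: "simple_graph G \<Longrightarrow> finite (edges G)"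
  by (rule finite_subset[of _ "Pow (verts G)"]) (auto simp: simple_graph_def)

lemma edges_in_mono: "X \<subseteq> Y \<Longrightarrow> edges_in E X \<subseteq> edges_in E Y"
  by (auto simp: edges_in_def)

lemma edges_in_subset: "edges_in E X \<subseteq> E"
  by (auto simp: edges_in_def)

lemma edges_in_edges_in: "Y \<subseteq> X \<Longrightarrow> edges_in (edges_in E X) Y = edges_in E Y"
  by (auto simp: edges_in_def)

subsection \<open>Chromatic number\<close>

text \<open>An injective colouring of the finite vertex set works, so the \<open>LEAST\<close> in
  \<open>chromatic_number\<close> is attained.\<close>

lemma ex_proper_colouring:
  assumes "simple_graph G"
  shows "\<exists>k f. proper_colouring G k f"
proof -
  have fin: "finite (verts G)" and E: "\<forall>e\<in>edges G. e \<subseteq> verts G \<and> card e = 2"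
    using assms by (auto simp: simple_graph_def)
  obtain f :: "'a \<Rightarrow> nat" and n where f: "f ` verts G = {i. i < n}" "inj_on f (verts G)"
    using finite_imp_inj_to_nat_seg[OF fin] by blast
  have "f u \<noteq> f v" if "{u, v} \<in> edges G" for u v
  proof -
    have "card {u, v} = 2" "u \<in> verts G" "v \<in> verts G" using E that by auto
    then have "u \<noteq> v" by auto
    with \<open>u \<in> verts G\<close> \<open>v \<in> verts G\<close> show ?thesis using inj_on_eq_iff[OF f(2)] by simp
  qed
  moreover have "f v < n" if "v \<in> verts G" for v
    using f(1) that by blast
  ultimately have "proper_colouring G n f" by (simp add: proper_colouring_def)
  then show ?thesis by blast
qed

lemma chromatic_number_le: "proper_colouring G k f \<Longrightarrow> chromatic_number G \<le> k"
  unfolding chromatic_number_def by (rule Least_le) blast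

lemma proper_colouring_chromatic_number:
  assumes "simple_graph G"
  shows "\<exists>f. proper_colouring G (chromatic_number G) f"
  unfolding chromatic_number_def using ex_proper_colouring[OF assms] by (rule LeastI_ex)

lemma less_chromatic_numberI:
  assumes "simple_graph G" "\<And>f. \<not> proper_colouring G k f"
  shows "k < chromatic_number G"
proof (rule ccontr)
  assume "\<not> k < chromatic_number G"
  moreover obtain f where "proper_colouring G (chromatic_number G) f"
    using proper_colouring_chromatic_number[OF assms(1)] by blast
  ultimately have "proper_colouring G k f"
    unfolding proper_colouring_def by (simp add: not_less) (meson order_less_le_trans)
  with assms(2) show False by blast
qed

lemma chromatic_number_no_verts:
  assumes "simple_graph G" "verts G = {}"
  shows "chromatic_number G = 0"
proof -
  have "proper_colouring G 0 (\<lambda>_. 0)"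
    using assms by (auto simp: proper_colouring_def simple_graph_def)
  then show ?thesis using chromatic_number_le[of G 0 "\<lambda>_. 0"] by simp
qed

text \<open>An optimal colouring of the remaining graph extends by giving the deleted vertex a fresh
  colour, namely the number of colours already used.\<close>

lemma chromatic_number_delete_vertex:
  assumes "simple_graph G"
  shows "chromatic_number G \<le> Suc (chromatic_number (verts G - {v}, edges_in (edges G) (verts G - {v})))"
    (is "_ \<le> Suc (chromatic_number ?H)")
proof -
  have "simple_graph ?H"
    using assms by (auto simp: simple_graph_def edges_in_def)
  then obtain f where f: "proper_colouring ?H (chromatic_number ?H) f"
    using proper_colouring_chromatic_number by blast
  let ?k = "chromatic_number ?H"
  have "proper_colouring G (Suc ?k) (f(v := ?k))"
    unfolding proper_colouring_def
  proof (intro conjI ballI allI impI)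
    fix u assume "u \<in> verts G"
    then show "(f(v := ?k)) u < Suc ?k"
      using f by (auto simp: proper_colouring_def less_Suc_eq)
  next
    fix u w assume uw: "{u, w} \<in> edges G"
    then have sub: "u \<in> verts G" "w \<in> verts G" and "card {u, w} = 2"
      using assms by (auto simp: simple_graph_def)
    then have "u \<noteq> w" by auto
    have lt: "f x < ?k" if "x \<in> verts G" "x \<noteq> v" for x
      using f that by (auto simp: proper_colouring_def)
    have "f u \<noteq> f w" if "u \<noteq> v" "w \<noteq> v"
      using f that sub uw by (auto simp: proper_colouring_def edges_in_def)
    with sub \<open>u \<noteq> w\<close> show "(f(v := ?k)) u \<noteq> (f(v := ?k)) w"
      using lt[of u] lt[of w] by (cases "u = v"; cases "w = v") simp_all
  qed
  then show ?thesis by (rule chromatic_number_le)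
qed

lemma subgraph_trans: "subgraph H G \<Longrightarrow> subgraph G F \<Longrightarrow> subgraph H F"
  by (auto simp: subgraph_def)

text \<open>Discrete intermediate value argument: deleting one vertex lowers the chromatic number by
  at most one, so on the way down to the empty graph no value is skipped. It turns "at least 4" into
  "exactly 4" at the end.\<close>

lemma subgraph_chromatic_number_eq:
  assumes "simple_graph G" "k \<le> chromatic_number G"
  shows "\<exists>H. subgraph H G \<and> chromatic_number H = k"
  using assms
proof (induction "card (verts G)" arbitrary: G rule: less_induct)
  case less
  show ?case
  proof (cases "chromatic_number G = k")
    case True
    then show ?thesis using less.prems unfolding subgraph_def by blast
  next
    case False
    with less.prems have gt: "k < chromatic_number G" by simp
    then have "verts G \<noteq> {}"
      using chromatic_number_no_verts[OF less.prems(1)] by auto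
    then obtain v where v: "v \<in> verts G" by blast
    let ?H = "(verts G - {v}, edges_in (edges G) (verts G - {v}))"
    have sH: "simple_graph ?H"
      using less.prems by (auto simp: simple_graph_def edges_in_def)
    have "finite (verts G)" using less.prems by (simp add: simple_graph_def)
    then have "card (verts ?H) < card (verts G)"
      using v card_Diff1_less[of "verts G" v] by simp
    moreover have "k \<le> chromatic_number ?H"
      using chromatic_number_delete_vertex[OF less.prems(1), of v] gt by linarith
    ultimately obtain H where "subgraph H ?H" "chromatic_number H = k"
      using less.hyps[of ?H] sH by blast
    moreover have "subgraph ?H G" using sH by (simp add: subgraph_def edges_in_def subset_iff)
    ultimately show ?thesis using subgraph_trans by blast
  qed
qed

section \<open>Cycles and girth in subgraphs\<close>

lemma cycle_subgraph: "cycle H vs \<Longrightarrow> subgraph H G \<Longrightarrow> cycle G vs"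
  by (auto simp: cycle_def subgraph_def)

lemma girth_ge_imp_length_ge:
  assumes "enat k \<le> girth G" "cycle G vs"
  shows "k \<le> length vs"
proof -
  have "girth G \<le> enat (length vs)"
    unfolding girth_def using assms(2) by (intro INF_lower) simp
  with assms(1) have "enat k \<le> enat (length vs)" by (rule order_trans)
  then show ?thesis by simp
qed

lemma girth_ge5I:
  assumes "\<And>vs. cycle G vs \<Longrightarrow> length vs \<noteq> 3 \<and> length vs \<noteq> 4"
  shows "5 \<le> girth G"
  unfolding girth_def
proof (rule INF_greatest)
  fix vs assume "vs \<in> {vs. cycle G vs}"
  then have vs: "cycle G vs" by simp
  then have "3 \<le> length vs" by (simp add: cycle_def)
  with assms[OF vs] have "5 \<le> length vs" by linarith
  then have "enat 5 \<le> enat (length vs)" by (rule enat_ord_simps(1)[THEN iffD2])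
  then show "5 \<le> enat (length vs)" by (simp add: numeral_eq_enat)
qed

subsection \<open>Degrees, walks and short cycles\<close>

lemma card_nbrs_le: 
  assumes "finite E" 
  shows "finite (nbrs E v)" "card (nbrs E v) \<le> card {e\<in>E. v \<in> e}"
proof -
  have inj: "inj_on (\<lambda>u. {u, v}) (nbrs E v)"
    by (auto simp: inj_on_def doubleton_eq_iff)
  have sub: "(\<lambda>u. {u, v}) ` nbrs E v \<subseteq> {e\<in>E. v \<in> e}"
    by (auto simp: nbrs_def)
  have fin: "finite {e\<in>E. v \<in> e}" using assms by simp
  show "finite (nbrs E v)"
    using finite_imageD[OF finite_subset[OF sub fin] inj] .
  show "card (nbrs E v) \<le> card {e\<in>E. v \<in> e}"
    using card_inj_on_le[OF inj sub fin] .
qed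

text \<open>Handshake lemma by double counting of incident pairs; only the upper bound is
  required.\<close>

lemma sum_card_nbrs_le:
  assumes "simple_graph (V, E)"
  shows "(\<Sum>v\<in>V. card (nbrs E v)) \<le> 2 * card E"
proof -
  have finE: "finite E" using simple_graph_finite_edges[OF assms] by simp
  have finV: "finite V" using assms by (simp add: simple_graph_def)
  have "(\<Sum>v\<in>V. card (nbrs E v)) \<le> (\<Sum>v\<in>V. card {e\<in>E. v \<in> e})"
    by (intro sum_mono card_nbrs_le finE)
  also have "\<dots> = (\<Sum>e\<in>E. card {v\<in>V. v \<in> e})"
    using sum.swap_restrict[OF finV finE, of "\<lambda>_ _. 1::nat" "\<lambda>v e. v \<in> e"] by simp
  also have "\<dots> = (\<Sum>e\<in>E. 2)"
  proof (rule sum.cong)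
    fix e assume "e \<in> E"
    then have "{v\<in>V. v \<in> e} = e" "card e = 2" using assms by (auto simp: simple_graph_def)
    then show "card {v\<in>V. v \<in> e} = 2" by simp
  qed simp
  also have "\<dots> = 2 * card E" by simp
  finally show ?thesis .
qed

lemma card_walks_le:
  assumes "finite V" "finite E" and deg: "\<And>v. v \<in> V \<Longrightarrow> real (card (nbrs E v)) \<le> \<Delta>"
    and "0 \<le> \<Delta>"
  shows "finite (walks V E k) \<and> real (card (walks V E k)) \<le> real (card V) * \<Delta> ^ k"
proof (induction k)
  case 0
  have "walks V E 0 = (\<lambda>v. [v]) ` V"
    by (auto simp: walks_def length_Suc_conv)
  then show ?case using assms(1) by (simp add: card_image_le)
next
  case (Suc k)
  let ?S = "Sigma (walks V E k) (\<lambda>vs. nbrs E (hd vs))"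
  have finS: "finite ?S" using Suc card_nbrs_le(1)[OF assms(2)] by (intro finite_SigmaI) auto
  \<comment> \<open>A walk is extended at its head: removing the first vertex leaves a shorter walk,
    and that vertex is one of at most \<open>\<Delta>\<close> neighbours of the new head.\<close>
  have "walks V E (Suc k) \<subseteq> (\<lambda>(vs, u). u # vs) ` ?S"
  proof
    fix ws assume ws: "ws \<in> walks V E (Suc k)"
    then obtain u vs where w: "ws = u # vs" "length vs = Suc k"
      by (auto simp: walks_def length_Suc_conv)
    have e: "{ws ! i, ws ! Suc i} \<in> E" if "Suc i < length ws" for i
      using ws that by (auto simp: walks_def)
    have "vs \<in> walks V E k"
      using ws w e[of "Suc _"] by (auto simp: walks_def)
    moreover have "u \<in> nbrs E (hd vs)"
      using e[of 0] w by (cases vs) (auto simp: nbrs_def)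
    ultimately show "ws \<in> (\<lambda>(vs, u). u # vs) ` ?S" using w by force
  qed
  then have fin: "finite (walks V E (Suc k))" and "card (walks V E (Suc k)) \<le> card ?S"
    using finS by (auto intro: finite_subset surj_card_le)
  moreover have "real (card ?S) \<le> real (card V) * \<Delta> ^ Suc k"
  proof -
    have "real (card ?S) = (\<Sum>vs\<in>walks V E k. real (card (nbrs E (hd vs))))"
      using Suc card_nbrs_le(1)[OF assms(2)] by simp
    also have "\<dots> \<le> (\<Sum>vs\<in>walks V E k. \<Delta>)"
    proof (intro sum_mono deg)
      fix vs assume "vs \<in> walks V E k"
      then show "hd vs \<in> V" by (cases vs) (auto simp: walks_def)
    qed
    also have "\<dots> = real (card (walks V E k)) * \<Delta>" by simp
    also have "\<dots> \<le> (real (card V) * \<Delta> ^ k) * \<Delta>"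
      using Suc assms(4) by (intro mult_right_mono) auto
    finally show ?thesis by (simp add: mult_ac)
  qed
  ultimately show ?case by linarith
qed

text \<open>The number of distinct edges is the exponent of \<open>p\<close> in the probability that
  the cycle survives random sampling. For the two lengths of interest, distinctness is checked on
  the explicit list of edges.\<close>

lemma card_cycle_edges:
  assumes "distinct vs" "length vs = 3 \<or> length vs = 4"
  shows "card (cycle_edges vs) = length vs"
  using assms(2)
proof
  assume "length vs = 3"
  then obtain a b c where vs: "vs = [a, b, c]"
    by (auto simp: length_Suc_conv numeral_eq_Suc)
  have "{i. Suc i < length vs} = {0, 1}" unfolding vs by auto
  then have "cycle_edges vs = {{c, a}, {a, b}, {b, c}}"
    using vs by (simp add: cycle_edges_def)
  moreover have "{c, a} \<noteq> {a, b}" "{c, a} \<noteq> {b, c}" "{a, b} \<noteq> {b, c}"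
    using assms(1) unfolding vs doubleton_eq_iff by auto
  ultimately show ?thesis by (simp add: vs)
next
  assume "length vs = 4"
  then obtain a b c d where vs: "vs = [a, b, c, d]"
    by (auto simp: length_Suc_conv numeral_eq_Suc)
  have "{i. Suc i < length vs} = {0, 1, 2}" unfolding vs by auto
  then have "cycle_edges vs = {{d, a}, {a, b}, {b, c}, {c, d}}"
    using vs by (simp add: cycle_edges_def numeral_eq_Suc)
  moreover have "{d, a} \<noteq> {a, b}" "{d, a} \<noteq> {b, c}" "{d, a} \<noteq> {c, d}"
    "{a, b} \<noteq> {b, c}" "{a, b} \<noteq> {c, d}" "{b, c} \<noteq> {c, d}"
    using assms(1) unfolding vs doubleton_eq_iff by auto
  ultimately show ?thesis by (simp add: vs)
qed

lemma cycle_imp_cycle_edges: "cycle G vs \<Longrightarrow> cycle_edges vs \<subseteq> edges G"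
  by (auto simp: cycle_def cycle_edges_def)

lemma cycle_imp_walk: "cycle (V, E) vs \<Longrightarrow> vs \<in> walks V E (length vs - 1)"
  by (auto simp: cycle_def walks_def)

subsection \<open>Random edge sets\<close>

text \<open>The probability that the outcome is \<open>S\<close> when each element of
  \<open>E\<close> is kept independently with probability \<open>p\<close>. Expectations become
  finite sums over \<open>Pow E\<close>.\<close>

definition bernoulli_weight :: "real \<Rightarrow> 'b set \<Rightarrow> 'b set \<Rightarrow> real" where
  "bernoulli_weight p E S = p ^ card S * (1 - p) ^ card (E - S)"

lemma sum_bernoulli_weight_superset:
  assumes "finite E" "F \<subseteq> E"
  shows "(\<Sum>S\<in>Pow E. bernoulli_weight p E S * of_bool (F \<subseteq> S)) = p ^ card F"
proof -
  \<comment> \<open>Replacing the factor \<open>1 - p\<close> by zero on \<open>F\<close> kills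
    exactly the sets \<open>S\<close> that miss an element of \<open>F\<close>; the sum is then the
    expansion of a product of binomials over \<open>E\<close>.\<close>
  let ?g = "\<lambda>e. if e \<in> F then 0 else 1 - p"
  have "(\<Sum>S\<in>Pow E. bernoulli_weight p E S * of_bool (F \<subseteq> S)) =
    (\<Sum>S\<in>Pow E. prod (\<lambda>_. p) S * prod ?g (E - S))"
  proof (rule sum.cong)
    fix S assume "S \<in> Pow E"
    show "bernoulli_weight p E S * of_bool (F \<subseteq> S) = prod (\<lambda>_. p) S * prod ?g (E - S)"
    proof (cases "F \<subseteq> S")
      case True
      then have "prod ?g (E - S) = prod (\<lambda>_. 1 - p) (E - S)"
        by (intro prod.cong) auto
      then show ?thesis using True by (simp add: bernoulli_weight_def)
    next
      case False
      then have "prod ?g (E - S) = 0"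
        using assms by (auto intro!: prod_zero)
      then show ?thesis using False by simp
    qed
  qed simp
  also have "\<dots> = (\<Prod>e\<in>E. p + ?g e)"
    by (simp only: prod_add[OF assms(1)])
  also have "\<dots> = (\<Prod>e\<in>E. if e \<in> F then p else 1)"
    by (intro prod.cong) auto
  also have "\<dots> = p ^ card F"
    using assms by (simp add: prod.If_cases Int_absorb1)
  finally show ?thesis .
qed

lemma sum_bernoulli_weight: "finite E \<Longrightarrow> (\<Sum>S\<in>Pow E. bernoulli_weight p E S) = 1"
  using sum_bernoulli_weight_superset[of E "{}" p] by simp

text \<open>The generating function at 1/2 of the binomially distributed number of sampled elements
  of \<open>A\<close>. This is the exponential moment behind a Chernoff bound for the lower
  tail.\<close>

lemma sum_bernoulli_weight_half_power:
  assumes "finite E" "A \<subseteq> E"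
  shows "(\<Sum>S\<in>Pow E. bernoulli_weight p E S * (1/2) ^ card (S \<inter> A)) = (1 - p/2) ^ card A"
proof -
  let ?f = "\<lambda>e. if e \<in> A then p/2 else p"
  have "(\<Sum>S\<in>Pow E. bernoulli_weight p E S * (1/2) ^ card (S \<inter> A)) =
    (\<Sum>S\<in>Pow E. prod ?f S * prod (\<lambda>_. 1 - p) (E - S))"
  proof (rule sum.cong)
    fix S assume "S \<in> Pow E"
    then have "finite S" using assms(1) finite_subset by blast
    have "prod ?f S = (\<Prod>e\<in>S. p * (if e \<in> A then 1/2 else 1))"
      by (intro prod.cong) auto
    also have "\<dots> = p ^ card S * (1/2) ^ card (S \<inter> A)"
      using \<open>finite S\<close> by (simp add: prod.distrib prod.If_cases)
    finally show "bernoulli_weight p E S * (1/2) ^ card (S \<inter> A) =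
        prod ?f S * prod (\<lambda>_. 1 - p) (E - S)"
      by (simp add: bernoulli_weight_def)
  qed simp
  also have "\<dots> = (\<Prod>e\<in>E. ?f e + (1 - p))"
    by (simp only: prod_add[OF assms(1)])
  also have "\<dots> = (\<Prod>e\<in>E. if e \<in> A then 1 - p/2 else 1)"
    by (intro prod.cong) auto
  also have "\<dots> = (1 - p/2) ^ card A"
    using assms by (simp add: prod.If_cases Int_absorb1)
  finally show ?thesis .
qed

text \<open>First moment method: the weights are nonnegative and sum to 1, so \<open>\<Phi>\<close>
  cannot be at least 1 on every outcome.\<close>

lemma ex_less_of_bernoulli_expectation_less:
  assumes "finite E" "0 \<le> p" "p \<le> 1"
    and "(\<Sum>S\<in>Pow E. bernoulli_weight p E S * \<Phi> S) < 1"
  shows "\<exists>S\<subseteq>E. \<Phi> S < 1"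
proof (rule ccontr)
  assume "\<not> ?thesis"
  then have "(\<Sum>S\<in>Pow E. bernoulli_weight p E S * 1) \<le> (\<Sum>S\<in>Pow E. bernoulli_weight p E S * \<Phi> S)"
    using assms(2,3) by (intro sum_mono mult_left_mono) (auto simp: bernoulli_weight_def not_less)
  then show False using sum_bernoulli_weight[OF assms(1), of p] assms(4) by simp
qed

text \<open>Sampling with deletion. With \<open>n = card V\<close>, some sample \<open>S\<close>
  contains fewer than \<open>n\<close> listings of cycles of length 3 or 4 and yet more than
  \<open>n\<close> edges inside every third of \<open>V\<close>. Removing one edge per listing
  leaves an edge in every third, so none of these sets can lie in a colour class.\<close>

lemma sparse_4_chromatic_subgraph:
  assumes G: "simple_graph (V, E)" and "V \<noteq> {}"
    and deg: "\<And>v. v \<in> V \<Longrightarrow> real (card (nbrs E v)) \<le> \<Delta>" and "0 \<le> \<Delta>"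
    and dense: "\<And>Y. Y \<subseteq> V \<Longrightarrow> card V \<le> 3 * card Y \<Longrightarrow> m \<le> real (card (edges_in E Y))"
    and p: "0 \<le> p" "p \<le> 1" "8 * real (card V) \<le> p * m"
    and few_cycles: "\<Delta>\<^sup>2 * p ^ 3 + \<Delta> ^ 3 * p ^ 4 \<le> 1/2"
  shows "\<exists>H. subgraph H (V, E) \<and> girth H \<ge> 5 \<and> chromatic_number H \<ge> 4"
proof -
  define n where "n = card V"
  have finE: "finite E" using simple_graph_finite_edges[OF G] by simp
  have finV: "finite V" using G by (simp add: simple_graph_def)
  have "n > 0" using finV \<open>V \<noteq> {}\<close> by (simp add: n_def card_gt_0_iff)
  define C where "C l = {vs. cycle (V, E) vs \<and> length vs = l}" for l
  define Ys where "Ys = {Y. Y \<subseteq> V \<and> n \<le> 3 * card Y}"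
  have finYs: "finite Ys" and cardYs: "card Ys \<le> 2 ^ n"
  proof -
    have sub: "Ys \<subseteq> Pow V" by (auto simp: Ys_def)
    then show "finite Ys" using finV by (simp add: finite_subset)
    show "card Ys \<le> 2 ^ n"
      using card_mono[OF _ sub] finV by (simp add: n_def card_Pow)
  qed
  have C: "finite (C (Suc k))" "real (card (C (Suc k))) \<le> n * \<Delta> ^ k" for k
  proof -
    \<comment> \<open>Forgetting the closing edge makes a cycle listing a walk with \<open>k\<close>
      edges. Listings count each cycle several times, which is harmless for an upper bound.\<close>
    have sub: "C (Suc k) \<subseteq> walks V E k" 
    proof
      fix vs assume "vs \<in> C (Suc k)"
      then show "vs \<in> walks V E k" using cycle_imp_walk[of V E vs] by (simp add: C_def)
    qed
    have w: "finite (walks V E k)" "real (card (walks V E k)) \<le> n * \<Delta> ^ k"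
      using card_walks_le[OF finV finE deg \<open>0 \<le> \<Delta>\<close>, of k] by (auto simp: n_def)
    show "finite (C (Suc k))" using finite_subset[OF sub w(1)] .
    show "real (card (C (Suc k))) \<le> n * \<Delta> ^ k"
      using card_mono[OF w(1) sub] w(2) by linarith
  qed
  define B where "B = C 3 \<union> C 4"
  have finB: "finite B" using C(1)[of 2] C(1)[of 3] by (simp add: B_def numeral_eq_Suc)
  \<comment> \<open>Both quantities are scaled so that 1 is the threshold: \<open>cyc S < 1\<close>
    means fewer than \<open>n\<close> short cycle listings in \<open>S\<close>, and
    \<open>bad S Y < 1\<close> means more than \<open>n\<close> sampled edges inside
    \<open>Y\<close>.\<close>
  define cyc where "cyc S = real (card {vs\<in>B. cycle_edges vs \<subseteq> S}) / n" for S
  define bad where "bad S Y = (2::real) ^ n * (1/2) ^ card (S \<inter> edges_in E Y)" for S Y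
  have E_cyc: "(\<Sum>S\<in>Pow E. bernoulli_weight p E S * cyc S) \<le> 1/2"
  proof -
    have "(\<Sum>S\<in>Pow E. bernoulli_weight p E S * cyc S) =
      (\<Sum>S\<in>Pow E. \<Sum>vs\<in>B. bernoulli_weight p E S * of_bool (cycle_edges vs \<subseteq> S) / n)"
    proof (rule sum.cong)
      fix S
      have "real (card {vs\<in>B. cycle_edges vs \<subseteq> S}) = (\<Sum>vs\<in>B. of_bool (cycle_edges vs \<subseteq> S))"
        using finB by (simp add: Int_def)
      then show "bernoulli_weight p E S * cyc S =
          (\<Sum>vs\<in>B. bernoulli_weight p E S * of_bool (cycle_edges vs \<subseteq> S) / n)"
        unfolding cyc_def by (simp only: sum_distrib_left sum_divide_distrib times_divide_eq_right)
    qed simp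
    also have "\<dots> = (\<Sum>vs\<in>B. \<Sum>S\<in>Pow E. bernoulli_weight p E S * of_bool (cycle_edges vs \<subseteq> S) / n)"
      by (rule sum.swap)
    also have "\<dots> = (\<Sum>vs\<in>B. p ^ length vs / n)"
    proof (rule sum.cong)
      fix vs assume "vs \<in> B"
      then have vs: "cycle (V, E) vs" "length vs = 3 \<or> length vs = 4"
        by (auto simp: B_def C_def)
      have "card (cycle_edges vs) = length vs"
        using card_cycle_edges[of vs] vs by (simp add: cycle_def)
      then show "(\<Sum>S\<in>Pow E. bernoulli_weight p E S * of_bool (cycle_edges vs \<subseteq> S) / n) =
          p ^ length vs / n"
        using sum_bernoulli_weight_superset[OF finE, of "cycle_edges vs" p]
          cycle_imp_cycle_edges[OF vs(1)] by (simp only: sum_divide_distrib[symmetric]) simp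
    qed simp
    also have "\<dots> = (\<Sum>vs\<in>C 3. p ^ length vs / n) + (\<Sum>vs\<in>C 4. p ^ length vs / n)"
      unfolding B_def using C(1)[of 2] C(1)[of 3]
      by (intro sum.union_disjoint) (auto simp: C_def numeral_eq_Suc)
    also have "\<dots> = card (C 3) * (p ^ 3 / n) + card (C 4) * (p ^ 4 / n)"
      by (simp add: C_def)
    also have "\<dots> \<le> (n * \<Delta>\<^sup>2) * (p ^ 3 / n) + (n * \<Delta> ^ 3) * (p ^ 4 / n)"
      using C(2)[of 2] C(2)[of 3] p(1) by (intro add_mono mult_right_mono) auto
    also have "\<dots> = \<Delta>\<^sup>2 * p ^ 3 + \<Delta> ^ 3 * p ^ 4" using \<open>n > 0\<close> by simp
    finally show ?thesis using few_cycles by linarith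
  qed
  have E_bad: "(\<Sum>S\<in>Pow E. bernoulli_weight p E S * (\<Sum>Y\<in>Ys. bad S Y)) \<le> 1/4"
  proof -
    have "(\<Sum>S\<in>Pow E. bernoulli_weight p E S * (\<Sum>Y\<in>Ys. bad S Y)) =
      (\<Sum>Y\<in>Ys. \<Sum>S\<in>Pow E. bernoulli_weight p E S * bad S Y)"
      by (simp only: sum_distrib_left) (rule sum.swap)
    \<comment> \<open>Since \<open>p * m\<close> is at least \<open>8 * n\<close>, the exponential
      moment is at most \<open>exp (- (4 * n))\<close>, hence at most \<open>(1/16) ^ n\<close>
      because \<open>exp 1\<close> is at least 2. The factor \<open>2 ^ n\<close> in
      \<open>bad\<close> and the union bound over at most \<open>2 ^ n\<close> sets together leave
      \<open>(1/4) ^ n\<close>.\<close>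
    also have "\<dots> \<le> (\<Sum>Y\<in>Ys. 2 ^ n * (1/16) ^ n)"
    proof (rule sum_mono)
      fix Y assume Y: "Y \<in> Ys"
      have "(\<Sum>S\<in>Pow E. bernoulli_weight p E S * bad S Y) =
        2 ^ n * (\<Sum>S\<in>Pow E. bernoulli_weight p E S * (1/2) ^ card (S \<inter> edges_in E Y))"
        by (simp add: bad_def sum_distrib_left mult_ac)
      also have "\<dots> = 2 ^ n * (1 - p/2) ^ card (edges_in E Y)"
        using sum_bernoulli_weight_half_power[OF finE edges_in_subset] by simp
      also have "(1 - p/2) ^ card (edges_in E Y) \<le> (1/16) ^ n"
      proof -
        have "(1 - p/2) ^ card (edges_in E Y) \<le> exp (- (p/2)) ^ card (edges_in E Y)"
          using p exp_ge_add_one_self[of "- (p/2)"] by (intro power_mono) auto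
        also have "\<dots> = exp (- (p * card (edges_in E Y) / 2))"
          by (simp add: exp_of_nat_mult[symmetric] mult_ac)
        also have "\<dots> \<le> exp (- (4 * n))"
        proof -
          have "p * m \<le> p * card (edges_in E Y)"
            using Y dense[of Y] p(1) by (intro mult_left_mono) (auto simp: Ys_def n_def)
          then show ?thesis using p(3) by (simp add: n_def)
        qed
        also have "\<dots> = (inverse (exp 1 ^ 4)) ^ n"
          by (simp add: exp_minus exp_of_nat_mult[symmetric] power_inverse power_mult[symmetric])
        also have "\<dots> \<le> (1/16) ^ n"
        proof (rule power_mono)
          have "2 ^ 4 \<le> (exp 1 :: real) ^ 4"
            using exp_ge_add_one_self[of 1] by (intro power_mono) auto
          then show "inverse (exp 1 ^ 4) \<le> (1/16 :: real)"
            by (simp add: field_simps)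
        qed simp
        finally show ?thesis .
      qed
      finally show "(\<Sum>S\<in>Pow E. bernoulli_weight p E S * bad S Y) \<le> 2 ^ n * (1/16) ^ n"
        by simp
    qed
    also have "\<dots> = card Ys * (2 ^ n * (1/16) ^ n)" by simp
    also have "\<dots> \<le> 2 ^ n * (2 ^ n * (1/16) ^ n)"
    proof (rule mult_right_mono)
      have "real (card Ys) \<le> real (2 ^ n)" using cardYs by (rule of_nat_mono)
      then show "real (card Ys) \<le> 2 ^ n" by simp
    qed simp
    also have "\<dots> = (1/4 :: real) ^ n" by (simp add: power_mult_distrib[symmetric])
    also have "\<dots> \<le> (1/4) ^ 1" using \<open>n > 0\<close> by (intro power_decreasing) auto
    finally show ?thesis by simp
  qed
  \<comment> \<open>Adding the two expectations, at most 1/2 and 1/4, yields a single sample that is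
    good in both respects.\<close>
  have "(\<Sum>S\<in>Pow E. bernoulli_weight p E S * (cyc S + (\<Sum>Y\<in>Ys. bad S Y))) < 1"
    using E_cyc E_bad by (simp add: distrib_left sum.distrib)
  from ex_less_of_bernoulli_expectation_less[OF finE p(1,2) this]
  obtain S where S: "S \<subseteq> E" and small: "cyc S + (\<Sum>Y\<in>Ys. bad S Y) < 1"
    by (elim exE conjE)
  have bad_nonneg: "0 \<le> bad S Y" for Y by (simp add: bad_def)
  define BS where "BS = {vs\<in>B. cycle_edges vs \<subseteq> S}"
  have "0 \<le> (\<Sum>Y\<in>Ys. bad S Y)" using bad_nonneg by (intro sum_nonneg)
  then have "cyc S < 1" using small by linarith
  then have cBS: "card BS < n" using \<open>n > 0\<close> by (simp add: cyc_def BS_def)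
  have many: "n < card (S \<inter> edges_in E Y)" if "Y \<in> Ys" for Y
  proof -
    have "0 \<le> cyc S" by (simp add: cyc_def)
    moreover have "bad S Y \<le> (\<Sum>Y\<in>Ys. bad S Y)"
      by (intro member_le_sum that bad_nonneg finYs)
    ultimately have "bad S Y < 1" using small by linarith
    then have "(2::real) ^ n < 2 ^ card (S \<inter> edges_in E Y)"
      by (simp add: bad_def field_simps)
    then show ?thesis by simp
  qed
  \<comment> \<open>The closing edge is the one sacrificed for each short cycle listing inside
    \<open>S\<close>.\<close>
  define D where "D = (\<lambda>vs. {last vs, hd vs}) ` BS"
  have finD: "finite D" and cD: "card D < n"
    using finB cBS card_image_le[of BS "\<lambda>vs. {last vs, hd vs}"] by (auto simp: D_def BS_def)
  let ?H = "(V, S - D)"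
  have H: "simple_graph ?H" using G S by (auto simp: simple_graph_def)
  have sub: "subgraph ?H (V, E)" using H S by (auto simp: subgraph_def)
  moreover have "5 \<le> girth ?H"
  proof (rule girth_ge5I, rule ccontr)
    fix vs assume vs: "cycle ?H vs" and "\<not> (length vs \<noteq> 3 \<and> length vs \<noteq> 4)"
    then have "vs \<in> B" using cycle_subgraph[OF vs sub] by (auto simp: B_def C_def)
    moreover have sub': "cycle_edges vs \<subseteq> S - D" using cycle_imp_cycle_edges[OF vs] by simp
    ultimately have "{last vs, hd vs} \<in> D" by (auto simp: BS_def D_def)
    then show False using sub' by (auto simp: cycle_edges_def)
  qed
  moreover have "3 < chromatic_number ?H"
  proof (rule less_chromatic_numberI[OF H], rule notI)
    fix f assume f: "proper_colouring ?H 3 f"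
    define W where "W i = {v\<in>V. f v = i}" for i :: nat
    have "f v = 0 \<or> f v = 1 \<or> f v = 2" if "v \<in> V" for v
      using f that by (auto simp: proper_colouring_def less_Suc_eq numeral_eq_Suc)
    then have V: "V = W 0 \<union> W 1 \<union> W 2" by (auto simp: W_def)
    have "card (W 0 \<union> W 1 \<union> W 2) \<le> card (W 0) + card (W 1) + card (W 2)"
      using card_Un_le[of "W 0 \<union> W 1" "W 2"] card_Un_le[of "W 0" "W 1"] by linarith
    then have "n \<le> card (W 0) + card (W 1) + card (W 2)"
      by (simp only: V[symmetric] n_def)
    then have "n \<le> 3 * card (W 0) \<or> n \<le> 3 * card (W 1) \<or> n \<le> 3 * card (W 2)" by linarith
    then obtain i where "n \<le> 3 * card (W i)" by blast
    \<comment> \<open>A colour class with at least a third of the vertices spans more than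
      \<open>n\<close> sampled edges, and fewer than \<open>n\<close> were deleted, so a
      monochromatic edge survives.\<close>
    then have "W i \<in> Ys" by (auto simp: Ys_def W_def)
    from many[OF this] have "card D < card (S \<inter> edges_in E (W i))" using cD by simp
    then have "\<not> S \<inter> edges_in E (W i) \<subseteq> D"
      using card_mono[OF finD, of "S \<inter> edges_in E (W i)"] by linarith
    then obtain e where e: "e \<in> S" "e \<notin> D" "e \<subseteq> W i" by (auto simp: edges_in_def)
    then have "card e = 2" using H by (auto simp: simple_graph_def)
    then obtain u v where uv: "e = {u, v}" by (auto simp: card_2_iff)
    then have "f u \<noteq> f v" using e f by (simp add: proper_colouring_def)
    moreover have "u \<in> W i" "v \<in> W i" using e uv by simp_all
    ultimately show False by (simp add: W_def)
  qed
  ultimately show ?thesis by (intro exI[of _ ?H]) simp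
qed

subsection \<open>Density decrement\<close>

lemma simple_graph_induced:
  "simple_graph G \<Longrightarrow> X \<subseteq> verts G \<Longrightarrow> simple_graph (X, edges_in (edges G) X)"
  by (auto simp: simple_graph_def edges_in_def intro: finite_subset)

lemma half_low_degree:
  assumes G: "simple_graph (V, E)"
  shows "card V \<le> 2 * card {v\<in>V. card (nbrs E v) * card V \<le> 4 * card E}" (is "_ \<le> 2 * card ?L")
proof -
  have finV: "finite V" using G by (simp add: simple_graph_def)
  \<comment> \<open>Markov's inequality for degrees, with denominators cleared. The strict degree
    bound outside \<open>?L\<close> supplies the \<open>+ 1\<close>, which keeps the common factor
    positive, and hence cancellable, even if \<open>E\<close> is empty.\<close>
  have "card (V - ?L) * (4 * card E + 1) = (\<Sum>v\<in>V - ?L. 4 * card E + 1)" by simp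
  also have "\<dots> \<le> (\<Sum>v\<in>V - ?L. card (nbrs E v) * card V)"
    by (intro sum_mono) auto
  also have "\<dots> \<le> (\<Sum>v\<in>V. card (nbrs E v) * card V)"
    using finV by (intro sum_mono2) auto
  also have "\<dots> = (\<Sum>v\<in>V. card (nbrs E v)) * card V" by (simp add: sum_distrib_right)
  also have "\<dots> \<le> (2 * card E) * card V"
    using sum_card_nbrs_le[OF G] by (intro mult_right_mono) auto
  finally have "card (V - ?L) * (4 * card E + 1) \<le> (2 * card E) * card V" .
  then have "2 * card (V - ?L) * (4 * card E + 1) \<le> 2 * ((2 * card E) * card V)"
    by (simp only: mult.assoc mult_le_mono2)
  also have "\<dots> \<le> card V * (4 * card E + 1)" by (simp add: algebra_simps)
  finally have "2 * card (V - ?L) * (4 * card E + 1) \<le> card V * (4 * card E + 1)" .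
  then have "2 * card (V - ?L) \<le> card V"
    unfolding mult_le_cancel2 by simp
  moreover have "card (V - ?L) = card V - card ?L"
    using finV by (intro card_Diff_subset) auto
  ultimately show ?thesis by linarith
qed

text \<open>Choose a vertex, discard it together with its neighbours, and repeat: each chosen vertex
  costs at most \<open>\<Delta> + 1\<close> vertices.\<close>

lemma greedy_independent_set:
  assumes E: "\<And>e. e \<in> E \<Longrightarrow> card e = 2" "finite E"
    and deg: "\<And>v. v \<in> W \<Longrightarrow> real (card (nbrs E v)) \<le> \<Delta>"
    and "finite W"
  shows "\<exists>I\<subseteq>W. edges_in E I = {} \<and> real (card W) \<le> (\<Delta> + 1) * card I"
  using \<open>finite W\<close> deg
proof (induction "card W" arbitrary: W rule: less_induct)
  case less
  show ?case
  proof (cases "W = {}")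
    case True
    have "edges_in E {} = {}" using E by (force simp: edges_in_def)
    then show ?thesis using True by auto
  next
    case False
    then obtain v where v: "v \<in> W" by blast
    let ?W = "W - insert v (nbrs E v)"
    have "card ?W < card W" using v less.prems(1) by (intro psubset_card_mono) auto
    then obtain I where I: "I \<subseteq> ?W" "edges_in E I = {}" "real (card ?W) \<le> (\<Delta> + 1) * card I"
      using less.hyps[of ?W] less.prems by auto
    have "finite I" "v \<notin> I" using I(1) less.prems(1) finite_subset by blast+
    have indep: "edges_in E (insert v I) = {}"
    proof (rule equals0I)
      fix e assume "e \<in> edges_in E (insert v I)"
      then have e: "e \<in> E" "e \<subseteq> insert v I" by (auto simp: edges_in_def)
      \<comment> \<open>As \<open>I\<close> is independent, an edge inside \<open>insert v I\<close>
        must use \<open>v\<close>; its other end would be a neighbour of \<open>v\<close>, and those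
        were removed.\<close>
      with I(2) have "v \<in> e" by (auto simp: edges_in_def)
      moreover obtain a b where "e = {a, b}" "a \<noteq> b" using E(1)[OF e(1)] by (auto simp: card_2_iff)
      ultimately obtain u where "e = {u, v}" "u \<noteq> v" by auto
      then have "u \<in> I" "u \<in> nbrs E v" using e by (auto simp: nbrs_def)
      then show False using I(1) by blast
    qed
    have "card W \<le> card (?W \<union> insert v (nbrs E v))"
      using less.prems(1) card_nbrs_le(1)[OF E(2), of v] by (intro card_mono) auto
    also have "\<dots> \<le> card ?W + card (insert v (nbrs E v))" by (rule card_Un_le)
    also have "card (insert v (nbrs E v)) \<le> Suc (card (nbrs E v))"
      by (simp add: card_insert_le_m1 card_insert_if card_nbrs_le(1)[OF E(2)])
    finally have "real (card W) \<le> real (card ?W) + 1 + \<Delta>"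
      using less.prems(2)[OF v] by linarith
    also have "\<dots> \<le> (\<Delta> + 1) * card (insert v I)"
      using I(3) \<open>finite I\<close> \<open>v \<notin> I\<close> by (simp add: algebra_simps)
    finally have "real (card W) \<le> (\<Delta> + 1) * card (insert v I)" .
    then show ?thesis using indep I(1) v by (intro exI[of _ "insert v I"]) auto
  qed
qed

text \<open>A weak form of Turan's bound: the greedy argument is run on the half of the vertices
  whose degree is at most four times the density. The factor 2 pays for the discarded half.\<close>

lemma independent_set_density:
  assumes G: "simple_graph (V, E)" and "V \<noteq> {}"
  shows "\<exists>I\<subseteq>V. edges_in E I = {} \<and>
    real (card V) \<le> 2 * (4 * (real (card E) / card V) + 1) * card I"
proof -
  let ?L = "{v\<in>V. card (nbrs E v) * card V \<le> 4 * card E}"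
  have finV: "finite V" using G by (simp add: simple_graph_def)
  have V0: "real (card V) > 0" using assms finV by (simp add: card_gt_0_iff)
  have "real (card (nbrs E v)) \<le> 4 * (real (card E) / card V)" if "v \<in> ?L" for v
  proof -
    have "card (nbrs E v) * card V \<le> 4 * card E" using that by simp
    then have "real (card (nbrs E v)) * real (card V) \<le> 4 * real (card E)"
      by (metis of_nat_le_iff of_nat_mult of_nat_numeral)
    then show ?thesis using V0 by (simp add: field_simps)
  qed
  moreover have "\<And>e. e \<in> E \<Longrightarrow> card e = 2" "finite E" "finite ?L"
    using G simple_graph_finite_edges[OF G] finV by (auto simp: simple_graph_def)
  ultimately obtain I where I: "I \<subseteq> ?L" "edges_in E I = {}"
    "real (card ?L) \<le> (4 * (real (card E) / card V) + 1) * card I"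
    using greedy_independent_set[of E ?L "4 * (real (card E) / card V)"] by blast
  have "real (card V) \<le> 2 * real (card ?L)" using half_low_degree[OF G] by linarith
  also have "\<dots> \<le> 2 * ((4 * (real (card E) / card V) + 1) * card I)" using I(3) by simp
  finally have "real (card V) \<le> 2 * (4 * (real (card E) / card V) + 1) * card I"
    by (simp only: mult.assoc)
  then show ?thesis using I(1,2) by blast
qed

text \<open>If every sixth of \<open>X\<close> kept a density above \<open>48 / q\<close> times that
  of \<open>X\<close>, sampling inside the low-degree half of \<open>X\<close> would produce the
  forbidden subgraph. A sixth arises as a third of a half.\<close>

lemma density_decrement_step:
  fixes q :: real
  assumes G: "simple_graph G" and X: "X \<subseteq> verts G" "X \<noteq> {}" and q: "1 \<le> q"
    and dense: "160 * q ^ 4 \<le> edge_density G X"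
    and no: "\<nexists>H. subgraph H G \<and> girth H \<ge> 5 \<and> chromatic_number H \<ge> 4"
  shows "\<exists>Y\<subseteq>X. card X \<le> 6 * card Y \<and> edge_density G Y \<le> 48 / q * edge_density G X"
proof (rule ccontr)
  assume contra: "\<not> ?thesis"
  define E where "E = edges G"
  define a where "a = edge_density G X"
  define W where "W = {v\<in>X. card (nbrs (edges_in E X) v) * card X \<le> 4 * card (edges_in E X)}"
  have a_def': "a = real (card (edges_in E X)) / real (card X)" by (simp add: a_def edge_density_def E_def)
  have finX: "finite X" using G X by (auto simp: simple_graph_def intro: finite_subset)
  then have X0: "real (card X) > 0" using X by (simp add: card_gt_0_iff)
  have q4: "1 \<le> q ^ 4" "q \<le> q ^ 4" "q ^ 3 \<le> q ^ 4"
    using q by (auto intro: power_increasing[of 1 4 q, simplified] power_increasing)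
  have a: "160 * q ^ 4 \<le> a" using dense by (simp add: a_def)
  have "a > 0" "q > 0" using a q4 q by linarith+
  have GX: "simple_graph (X, edges_in E X)"
    using simple_graph_induced[OF G X(1)] by (simp add: E_def)
  have "W \<subseteq> X" by (auto simp: W_def)
  have XW: "card X \<le> 2 * card W" using half_low_degree[OF GX] by (simp add: W_def)
  have "W \<noteq> {}" using XW X0 by auto
  have finE: "finite E" using simple_graph_finite_edges[OF G] by (simp add: E_def)
  have "\<exists>H. subgraph H (W, edges_in E W) \<and> girth H \<ge> 5 \<and> chromatic_number H \<ge> 4"
  \<comment> \<open>For \<open>Y\<close> with \<open>card X \<le> 6 * card Y\<close>, density above
    \<open>48 / q * a\<close> means more than \<open>8 * card X * (a / q)\<close> edges, which is
    the choice of \<open>m\<close>; the probability \<open>q / a\<close> then makes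
    \<open>p * m\<close> equal to \<open>8 * card X\<close>.\<close>
  proof (rule sparse_4_chromatic_subgraph[where \<Delta> = "4 * a" and p = "q / a" and m = "8 * card X * (a / q)"])
    show "simple_graph (W, edges_in E W)"
      using simple_graph_induced[OF G, of W] \<open>W \<subseteq> X\<close> X(1) by (auto simp: E_def)
    show "W \<noteq> {}" by fact
    show "real (card (nbrs (edges_in E W) v)) \<le> 4 * a" if "v \<in> W" for v
    proof -
      have "nbrs (edges_in E W) v \<subseteq> nbrs (edges_in E X) v"
        using edges_in_mono[OF \<open>W \<subseteq> X\<close>, of E] by (auto simp: nbrs_def)
      moreover have "finite (nbrs (edges_in E X) v)"
        using card_nbrs_le(1)[OF finite_subset[OF edges_in_subset finE]] .
      ultimately have "card (nbrs (edges_in E W) v) * card X \<le> card (nbrs (edges_in E X) v) * card X"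
        by (intro mult_right_mono card_mono) auto
      also have "\<dots> \<le> 4 * card (edges_in E X)" using that by (simp add: W_def)
      finally have "real (card (nbrs (edges_in E W) v)) * real (card X) \<le> 4 * real (card (edges_in E X))"
        by (metis of_nat_le_iff of_nat_mult of_nat_numeral)
      then show ?thesis using X0 by (simp add: a_def' field_simps)
    qed
    show "0 \<le> 4 * a" using \<open>a > 0\<close> by simp
    show "8 * card X * (a / q) \<le> real (card (edges_in (edges_in E W) Y))"
      if Y: "Y \<subseteq> W" "card W \<le> 3 * card Y" for Y
    proof -
      have XY: "card X \<le> 6 * card Y" using XW Y(2) by linarith
      then have Y0: "real (card Y) > 0" using X0 by linarith
      have "48 / q * a < edge_density G Y"
        using contra XY Y(1) \<open>W \<subseteq> X\<close> unfolding a_def by (meson not_le order_trans)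
      then have "48 / q * a * card Y < real (card (edges_in E Y))"
        using Y0 by (simp add: edge_density_def E_def field_simps)
      moreover have "8 * card X * (a / q) \<le> 8 * (6 * card Y) * (a / q)"
      proof -
        have "real (card X) \<le> 6 * real (card Y)" using XY by linarith
        then show ?thesis using \<open>a > 0\<close> \<open>q > 0\<close> by (intro mult_right_mono) auto
      qed
      ultimately show ?thesis using edges_in_edges_in[OF Y(1), of E] by (simp add: mult_ac)
    qed
    show "0 \<le> q / a" using \<open>a > 0\<close> \<open>q > 0\<close> by simp
    show "q / a \<le> 1" using a q4 \<open>a > 0\<close> by (simp add: field_simps)
    have "card W \<le> card X" using card_mono[OF finX \<open>W \<subseteq> X\<close>] .
    moreover have "q / a * (8 * card X * (a / q)) = 8 * card X"
      using \<open>a > 0\<close> \<open>q > 0\<close> by simp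
    ultimately show "8 * real (card W) \<le> q / a * (8 * card X * (a / q))" by simp
    \<comment> \<open>The cycle count is at most \<open>80 * q ^ 4 / a\<close>; this is where the
      density threshold \<open>160 * q ^ 4\<close> comes from.\<close>
    have "(4 * a)\<^sup>2 * (q / a) ^ 3 + (4 * a) ^ 3 * (q / a) ^ 4 = (16 * q ^ 3 + 64 * q ^ 4) / a"
      using \<open>a > 0\<close> by (simp add: field_simps power2_eq_square power3_eq_cube power4_eq_xxxx)
    also have "\<dots> \<le> (80 * q ^ 4) / a"
      using q4 \<open>a > 0\<close> by (intro divide_right_mono) auto
    also have "\<dots> \<le> 1/2" using a \<open>a > 0\<close> by (simp add: field_simps)
    finally show "(4 * a)\<^sup>2 * (q / a) ^ 3 + (4 * a) ^ 3 * (q / a) ^ 4 \<le> 1/2" .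
  qed
  then obtain H where "subgraph H (W, edges_in E W)" "girth H \<ge> 5" "chromatic_number H \<ge> 4" by blast
  moreover have "subgraph (W, edges_in E W) G"
    using simple_graph_induced[OF G, of W] \<open>W \<subseteq> X\<close> X(1) by (auto simp: subgraph_def E_def edges_in_def)
  ultimately show False using no subgraph_trans by blast
qed

text \<open>The decrement is iterated \<open>N\<close> times. The independence bound on
  \<open>X\<close> keeps every set met on the way above the density threshold, so each step applies
  and the last density is still at least \<open>160 * q ^ 4\<close>, although it has shrunk by
  \<open>(48 / q) ^ N\<close>.\<close>

lemma edge_bound_of_no_sparse_4_chromatic:
  fixes q \<beta> :: real
  assumes G: "simple_graph G" and X: "X \<subseteq> verts G" "X \<noteq> {}" and q: "1 \<le> q"
    and indep: "\<And>I. I \<subseteq> X \<Longrightarrow> edges_in (edges G) I = {} \<Longrightarrow> real (card I) \<le> \<beta> * card X"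
    and \<beta>: "0 \<le> \<beta>" "2 * (640 * q ^ 4 + 1) * \<beta> * 6 ^ N < 1"
    and no: "\<nexists>H. subgraph H G \<and> girth H \<ge> 5 \<and> chromatic_number H \<ge> 4"
  shows "160 * q ^ 4 \<le> (48 / q) ^ N * card (edges G)"
proof -
  have finX: "finite X" using G X by (auto simp: simple_graph_def intro: finite_subset)
  then have X0: "card X > 0" using X by (simp add: card_gt_0_iff)
  \<comment> \<open>A sparser \<open>Y\<close> would contain an independent set of size at least
    \<open>card Y / (2 * (640 * q ^ 4 + 1))\<close>, with 640 equal to 4 times 160. Independent sets
    have size at most \<open>\<beta> * card X\<close>, hence at most
    \<open>\<beta> * 6 ^ N * card Y\<close>, which is too small.\<close>
  have low: "160 * q ^ 4 \<le> edge_density G Y" if Y: "Y \<subseteq> X" "Y \<noteq> {}" "card X \<le> 6 ^ t * card Y" "t \<le> N" for t Y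
  proof (rule ccontr)
    assume less: "\<not> 160 * q ^ 4 \<le> edge_density G Y"
    have finY: "finite Y" using finX Y(1) finite_subset by blast
    then have Y0: "real (card Y) > 0" using Y(2) by (simp add: card_gt_0_iff)
    have GY: "simple_graph (Y, edges_in (edges G) Y)"
      using simple_graph_induced[OF G] X(1) Y(1) by blast
    obtain I where I: "I \<subseteq> Y" "edges_in (edges_in (edges G) Y) I = {}"
      "real (card Y) \<le> 2 * (4 * edge_density G Y + 1) * card I"
      using independent_set_density[OF GY Y(2)] by (auto simp: edge_density_def)
    have "real (card I) \<le> \<beta> * card X"
      using indep[of I] I(1,2) Y(1) by (simp add: edges_in_edges_in)
    also have "\<dots> \<le> \<beta> * (6 ^ N * real (card Y))"
    proof (rule mult_left_mono[OF _ \<beta>(1)])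
      have "real (card X) \<le> real (6 ^ t * card Y)" using Y(3) by (rule of_nat_mono)
      also have "\<dots> = 6 ^ t * real (card Y)" by simp
      also have "\<dots> \<le> 6 ^ N * real (card Y)"
        using Y(4) by (auto intro!: mult_right_mono power_increasing)
      finally show "real (card X) \<le> 6 ^ N * real (card Y)" .
    qed
    finally have cI: "real (card I) \<le> \<beta> * (6 ^ N * real (card Y))" .
    have "real (card Y) \<le> 2 * (4 * edge_density G Y + 1) * card I" by (fact I(3))
    also have "\<dots> \<le> 2 * (640 * q ^ 4 + 1) * card I"
      using less by (intro mult_right_mono) auto
    also have "\<dots> \<le> 2 * (640 * q ^ 4 + 1) * (\<beta> * (6 ^ N * real (card Y)))"
      using cI q by (intro mult_left_mono) auto
    also have "\<dots> = (2 * (640 * q ^ 4 + 1) * \<beta> * 6 ^ N) * card Y" by (simp only: mult.assoc)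
    also have "\<dots> < 1 * real (card Y)" using \<beta>(2) Y0 by (rule mult_strict_right_mono)
    finally show False by simp
  qed
  have "\<exists>Y\<subseteq>X. Y \<noteq> {} \<and> card X \<le> 6 ^ t * card Y \<and> edge_density G Y \<le> (48 / q) ^ t * edge_density G X"
    if "t \<le> N" for t
    using that
  proof (induction t)
    case 0
    show ?case using X by (intro exI[of _ X]) auto
  next
    case (Suc t)
    then obtain Y where Y: "Y \<subseteq> X" "Y \<noteq> {}" "card X \<le> 6 ^ t * card Y"
      "edge_density G Y \<le> (48 / q) ^ t * edge_density G X" by auto
    obtain Z where Z: "Z \<subseteq> Y" "card Y \<le> 6 * card Z" "edge_density G Z \<le> 48 / q * edge_density G Y"
      using density_decrement_step[OF G _ Y(2) q _ no] low[OF Y(1-3)] Suc.prems X(1) Y(1)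
      unfolding edge_density_def by (meson Suc_leD order_trans)
    have "edge_density G Z \<le> 48 / q * ((48 / q) ^ t * edge_density G X)"
      using Z(3) mult_left_mono[OF Y(4), of "48 / q"] q by auto
    moreover have "card X \<le> 6 ^ Suc t * card Z"
      using order_trans[OF Y(3) mult_le_mono2[OF Z(2)]] by (simp add: mult_ac)
    moreover have "Z \<noteq> {}" using Z(2) Y(1,2) finX by (auto simp: finite_subset card_eq_0_iff)
    ultimately show ?case using Z(1) Y(1) by (intro exI[of _ Z]) (auto simp: mult.assoc)
  qed
  then obtain Y where Y: "Y \<subseteq> X" "Y \<noteq> {}" "card X \<le> 6 ^ N * card Y"
    "edge_density G Y \<le> (48 / q) ^ N * edge_density G X" by blast
  have "160 * q ^ 4 \<le> (48 / q) ^ N * edge_density G X" using low[OF Y(1-3)] Y(4) by simp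
  \<comment> \<open>The initial density is bounded crudely by the total number of edges, using only
    that \<open>X\<close> has at least one vertex.\<close>
  also have "\<dots> \<le> (48 / q) ^ N * card (edges G)"
  proof (rule mult_left_mono)
    have "edge_density G X \<le> card (edges_in (edges G) X)"
      using X0 by (simp add: edge_density_def divide_le_eq mult_le_cancel_left1)
    also have "\<dots> \<le> card (edges G)"
      using card_mono[OF simple_graph_finite_edges[OF G] edges_in_subset] by simp
    finally show "edge_density G X \<le> card (edges G)" .
  qed (use q in simp)
  finally show ?thesis .
qed

text \<open>Each round removes an independent set containing a fraction \<open>\<beta>\<close> of
  what is left and gives it a colour of its own. After \<open>T\<close> rounds fewer than one
  vertex, hence none, remains.\<close>

lemma greedy_colouring:
  fixes \<beta> :: real
  assumes G: "simple_graph G" and \<beta>: "0 \<le> \<beta>" "\<beta> \<le> 1"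
    and indep: "\<And>X. X \<subseteq> verts G \<Longrightarrow> X \<noteq> {} \<Longrightarrow>
      \<exists>I\<subseteq>X. edges_in (edges G) I = {} \<and> \<beta> * card X \<le> card I"
    and "X \<subseteq> verts G" "(1 - \<beta>) ^ T * card X < 1"
  shows "\<exists>f. (\<forall>v\<in>X. f v < T) \<and> (\<forall>u\<in>X. \<forall>v\<in>X. {u, v} \<in> edges G \<longrightarrow> f u \<noteq> f v)"
  using assms(5,6)
proof (induction T arbitrary: X)
  case 0
  then have "X = {}" using G by (auto simp: simple_graph_def finite_subset)
  then show ?case by simp
next
  case (Suc T)
  show ?case
  proof (cases "X = {}")
    case False
    then obtain I where I: "I \<subseteq> X" "edges_in (edges G) I = {}" "\<beta> * card X \<le> card I"
      using indep[OF Suc.prems(1) False] by (elim exE conjE)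
    have finX: "finite X" using G Suc.prems(1) by (auto simp: simple_graph_def finite_subset)
    have "real (card (X - I)) = real (card X) - card I"
      using I(1) finX by (simp add: card_Diff_subset finite_subset card_mono of_nat_diff)
    then have "real (card (X - I)) \<le> (1 - \<beta>) * card X" using I(3) by (simp add: algebra_simps)
    then have "(1 - \<beta>) ^ T * card (X - I) \<le> (1 - \<beta>) ^ T * ((1 - \<beta>) * card X)"
      using \<beta> by (intro mult_left_mono) auto
    also have "\<dots> < 1" using Suc.prems(2) by (simp add: mult_ac)
    finally obtain f where f: "\<forall>v\<in>X - I. f v < T"
      "\<forall>u\<in>X - I. \<forall>v\<in>X - I. {u, v} \<in> edges G \<longrightarrow> f u \<noteq> f v"
      using Suc.IH[of "X - I"] Suc.prems(1) by blast
    \<comment> \<open>The induction uses colours below \<open>T\<close> on the rest, so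
      \<open>T\<close> itself is free for \<open>I\<close>.\<close>
    let ?f = "\<lambda>v. if v \<in> I then T else f v"
    have "?f u \<noteq> ?f v" if uv: "u \<in> X" "v \<in> X" "{u, v} \<in> edges G" for u v
    proof (cases "u \<in> I"; cases "v \<in> I")
      assume "u \<in> I" "v \<in> I"
      then have "{u, v} \<in> edges_in (edges G) I" using uv by (simp add: edges_in_def)
      with I(2) show ?thesis by simp
    next
      assume "u \<in> I" "v \<notin> I"
      then show ?thesis using f(1) uv by (simp add: less_imp_neq[symmetric])
    next
      assume "u \<notin> I" "v \<in> I"
      then show ?thesis using f(1) uv by (simp add: less_imp_neq)
    next
      assume "u \<notin> I" "v \<notin> I"
      then show ?thesis using f(2) uv by simp
    qed
    moreover have "?f v < Suc T" if "v \<in> X" for v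
      using f(1) that by (simp add: less_Suc_eq)
    ultimately show ?thesis by (intro exI[of _ ?f]) blast
  qed simp
qed

text \<open>If every nonempty vertex set had an independent subset of relative size at least
  \<open>\<beta>\<close>, greedy colouring would succeed with one colour fewer than the chromatic
  number.\<close>

lemma ex_small_independence_ratio:
  fixes \<beta> :: real
  assumes G: "simple_graph G" and \<beta>: "0 \<le> \<beta>" "\<beta> \<le> 1" and "2 \<le> chromatic_number G"
    and few: "(1 - \<beta>) ^ (chromatic_number G - 1) * (2 * card (edges G)) < 1"
  shows "\<exists>X\<subseteq>verts G. X \<noteq> {} \<and>
    (\<forall>I\<subseteq>X. edges_in (edges G) I = {} \<longrightarrow> real (card I) < \<beta> * card X)"
proof (rule ccontr)
  assume contra: "\<not> ?thesis"
  \<comment> \<open>Only the non-isolated vertices are coloured greedily: their number is at most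
    twice the number of edges, whereas isolated vertices could be arbitrarily many.\<close>
  define W where "W = \<Union>(edges G)"
  let ?T = "chromatic_number G - 1"
  have E: "\<And>e. e \<in> edges G \<Longrightarrow> e \<subseteq> verts G \<and> card e = 2" using G by (auto simp: simple_graph_def)
  have "card W \<le> (\<Sum>e\<in>edges G. card e)"
    unfolding W_def by (rule card_Union_le_sum_card)
  also have "\<dots> = 2 * card (edges G)" using E by simp
  finally have "real (card W) \<le> 2 * card (edges G)" by linarith
  then have "(1 - \<beta>) ^ ?T * card W \<le> (1 - \<beta>) ^ ?T * (2 * card (edges G))"
    using \<beta> by (intro mult_left_mono) auto
  then have "(1 - \<beta>) ^ ?T * card W < 1" using few by linarith
  moreover have "W \<subseteq> verts G" using E by (auto simp: W_def)
  moreover have "\<exists>I\<subseteq>X. edges_in (edges G) I = {} \<and> \<beta> * card X \<le> card I"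
    if "X \<subseteq> verts G" "X \<noteq> {}" for X
    using contra that by (meson not_le)
  ultimately obtain f where f: "\<forall>v\<in>W. f v < ?T"
    "\<forall>u\<in>W. \<forall>v\<in>W. {u, v} \<in> edges G \<longrightarrow> f u \<noteq> f v"
    using greedy_colouring[OF G \<beta>, of W ?T] by blast
  \<comment> \<open>Isolated vertices receive the default colour 0, which is a legal colour because
    \<open>?T\<close> is at least 1.\<close>
  have "proper_colouring G ?T (\<lambda>v. if v \<in> W then f v else 0)"
    unfolding proper_colouring_def
  proof (intro conjI ballI allI impI)
    fix v show "(if v \<in> W then f v else 0) < ?T" using f(1) assms(4) by auto
  next
    fix u v assume uv: "{u, v} \<in> edges G"
    then have "u \<in> W" "v \<in> W" by (auto simp: W_def)
    then show "(if u \<in> W then f u else 0) \<noteq> (if v \<in> W then f v else 0)" using f(2) uv by simp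
  qed
  then show False using chromatic_number_le assms(4) by fastforce
qed

subsection \<open>Asymptotics\<close>

text \<open>Here \<open>x\<close> stands for the chromatic number, with
  \<open>\<beta> = x powr (-1/2)\<close> and \<open>q = x powr (1/10)\<close>. The conditions after
  the first serve, in order, the failure of greedy colouring, the independence bound during
  \<open>N\<close> decrements, and the final contradiction. The second holds since the exponent
  grows like \<open>x powr (1/2)\<close>, the third since 2/5 is less than 1/2.\<close>

lemma eventually_parameters:
  fixes P C :: real and N :: nat
  assumes "C > 0" and N: "10 * P \<le> N"
  shows "eventually (\<lambda>x::real. 1 \<le> x \<and>
    exp (- (x powr (-1/2) * (x - 1))) * (2 * (C * x powr P)) < 1 \<and>
    2 * (640 * x powr (2/5) + 1) * x powr (-1/2) * 6 ^ N < 1 \<and>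
    48 ^ N * C < 160 * x powr (2/5)) at_top"
proof (intro eventually_conj)
  show "eventually (\<lambda>x::real. 1 \<le> x) at_top" by real_asymp
  show "eventually (\<lambda>x::real. exp (- (x powr (-1/2) * (x - 1))) * (2 * (C * x powr P)) < 1) at_top"
    using assms(1) by real_asymp
  have "((\<lambda>x::real. 2 * (640 * x powr (2/5) + 1) * x powr (-1/2) * 6 ^ N) \<longlongrightarrow> 0) at_top"
    by real_asymp
  then show "eventually (\<lambda>x::real. 2 * (640 * x powr (2/5) + 1) * x powr (-1/2) * 6 ^ N < 1) at_top"
    by (rule order_tendstoD) simp
  have "filterlim (\<lambda>x::real. 160 * x powr (2/5)) at_top at_top" by real_asymp
  then show "eventually (\<lambda>x::real. 48 ^ N * C < 160 * x powr (2/5)) at_top"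
    by (simp add: filterlim_at_top_dense)
qed

lemma sparse_4_chromatic_of_few_edges:
  fixes P C :: real
  assumes "C > 0"
  shows "\<exists>M::nat. \<forall>G :: 'a sgraph.
    simple_graph G \<and> chromatic_number G \<ge> M \<and>
    real (card (edges G)) \<le> C * real (chromatic_number G) powr P \<longrightarrow>
    (\<exists>H. subgraph H G \<and> girth H \<ge> 5 \<and> chromatic_number H \<ge> 4)"
proof -
  \<comment> \<open>With this many decrements \<open>q ^ N = x powr (N / 10)\<close> absorbs the
    factor \<open>x powr P\<close> from the edge bound.\<close>
  obtain N :: nat where N: "10 * P \<le> N" using real_arch_simple by blast
  obtain x0 where x0: "\<And>x::real. x0 \<le> x \<Longrightarrow> 1 \<le> x \<and>
    exp (- (x powr (-1/2) * (x - 1))) * (2 * (C * x powr P)) < 1 \<and>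
    2 * (640 * x powr (2/5) + 1) * x powr (-1/2) * 6 ^ N < 1 \<and>
    48 ^ N * C < 160 * x powr (2/5)"
    using eventually_parameters[OF assms N] unfolding eventually_at_top_linorder by blast
  \<comment> \<open>The lower bound 2 guarantees that at least one colour is left when the greedy
    colouring uses one fewer than the chromatic number.\<close>
  define M where "M = max 2 (nat \<lceil>x0\<rceil>)"
  have "\<exists>H. subgraph H G \<and> girth H \<ge> 5 \<and> chromatic_number H \<ge> 4"
    if G: "simple_graph G" and M: "M \<le> chromatic_number G"
      and e: "real (card (edges G)) \<le> C * real (chromatic_number G) powr P" for G :: "'a sgraph"
  proof (rule ccontr)
    assume no: "\<not> ?thesis"
    define k where "k = chromatic_number G"
    define x where "x = real k"
    define \<beta> where "\<beta> = x powr (-1/2)"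
    define q where "q = x powr (1/10)"
    have "2 \<le> k" "x0 \<le> x" using M by (auto simp: M_def k_def x_def)
    note x = x0[OF \<open>x0 \<le> x\<close>]
    have "1 \<le> x" using x by blast
    have \<beta>: "0 \<le> \<beta>" "\<beta> \<le> 1"
      using \<open>1 \<le> x\<close> powr_mono[of "-1/2" 0 x] by (auto simp: \<beta>_def)
    have q: "1 \<le> q" "q ^ 4 = x powr (2/5)" "q ^ N = x powr (N / 10)"
      using \<open>1 \<le> x\<close> by (auto simp: q_def ge_one_powr_ge_zero powr_power)
    have "(1 - \<beta>) ^ (k - 1) \<le> exp (- \<beta>) ^ (k - 1)"
      using \<beta> exp_ge_add_one_self[of "- \<beta>"] by (intro power_mono) auto
    also have "\<dots> = exp (- (\<beta> * (x - 1)))"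
      using \<open>2 \<le> k\<close> by (simp add: exp_of_nat_mult[symmetric] x_def of_nat_diff mult.commute)
    finally have "(1 - \<beta>) ^ (k - 1) * (2 * card (edges G)) \<le>
        exp (- (\<beta> * (x - 1))) * (2 * (C * x powr P))"
      using e by (intro mult_mono) (auto simp: x_def k_def)
    also have "\<dots> < 1" using x by (simp add: \<beta>_def)
    finally obtain X where X: "X \<subseteq> verts G" "X \<noteq> {}"
      "\<forall>I\<subseteq>X. edges_in (edges G) I = {} \<longrightarrow> real (card I) < \<beta> * card X"
      using ex_small_independence_ratio[OF G \<beta>] \<open>2 \<le> k\<close> unfolding k_def by blast
    have "160 * q ^ 4 \<le> (48 / q) ^ N * card (edges G)"
    proof (rule edge_bound_of_no_sparse_4_chromatic[OF G X(1,2) q(1) _ \<beta>(1) _ no])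
      show "real (card I) \<le> \<beta> * card X" if "I \<subseteq> X" "edges_in (edges G) I = {}" for I
        using X(3) that by (simp add: less_imp_le)
      show "2 * (640 * q ^ 4 + 1) * \<beta> * 6 ^ N < 1" using x by (simp add: q(2) \<beta>_def)
    qed
    \<comment> \<open>After inserting the edge bound only the constant \<open>48 ^ N * C\<close>
      survives, and this is below the growing quantity \<open>160 * q ^ 4\<close>.\<close>
    also have "\<dots> \<le> (48 / q) ^ N * (C * x powr P)"
      using e q(1) by (intro mult_left_mono) (auto simp: x_def k_def)
    also have "\<dots> = 48 ^ N * C * (x powr P / x powr (N / 10))"
      by (simp add: power_divide q(3))
    also have "\<dots> \<le> 48 ^ N * C * 1"
    proof (rule mult_left_mono)
      show "x powr P / x powr (N / 10) \<le> 1"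
        using powr_mono[of P "N / 10" x] N \<open>1 \<le> x\<close> by (simp add: divide_le_eq)
    qed (use assms in simp)
    also have "\<dots> < 160 * q ^ 4" using x by (simp add: q(2))
    finally show False by simp
  qed
  then show ?thesis by blast
qed

theorem corollary1p2:
  fixes P C :: real
  assumes "P > 0" and "C > 0"
  shows "(\<exists>M::nat. \<forall>G :: 'a sgraph.
            simple_graph G \<and> chromatic_number G \<ge> M \<and>
            real (card (edges G)) \<le> C * real (chromatic_number G) powr P \<longrightarrow>
            (\<exists>H. subgraph H G \<and> girth H \<ge> 5 \<and> chromatic_number H \<ge> 4)) \<and>
         (\<exists>M::nat. \<forall>G :: 'a sgraph.
            simple_graph G \<and> triangle_free G \<and> chromatic_number G \<ge> M \<and>
            real (card (edges G)) \<le> C * real (chromatic_number G) powr P \<longrightarrow>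
            (\<exists>H. subgraph H G \<and> C4_free H \<and> chromatic_number H = 4))"
proof -
  obtain M :: nat where M: "\<And>G :: 'a sgraph. simple_graph G \<Longrightarrow> M \<le> chromatic_number G \<Longrightarrow>
      real (card (edges G)) \<le> C * real (chromatic_number G) powr P \<Longrightarrow>
      \<exists>H. subgraph H G \<and> girth H \<ge> 5 \<and> chromatic_number H \<ge> 4"
    using sparse_4_chromatic_of_few_edges[OF assms(2), of P] by blast
  have "\<exists>H. subgraph H G \<and> C4_free H \<and> chromatic_number H = 4"
    if G: "simple_graph G" "M \<le> chromatic_number G"
      "real (card (edges G)) \<le> C * real (chromatic_number G) powr P" for G :: "'a sgraph"
  proof -
    obtain H where H: "subgraph H G" "girth H \<ge> 5" "chromatic_number H \<ge> 4"
      using M[OF G] by blast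
    then have "simple_graph H" by (simp add: subgraph_def)
    \<comment> \<open>Passing to \<open>F\<close> makes the chromatic number exactly 4 and creates
      no new cycle, so the girth bound on \<open>H\<close> still excludes 4-cycles.\<close>
    then obtain F where F: "subgraph F H" "chromatic_number F = 4"
      using subgraph_chromatic_number_eq H(3) by blast
    have "length vs \<noteq> 4" if "cycle F vs" for vs
      using girth_ge_imp_length_ge[of 5 H vs] cycle_subgraph[OF that F(1)] H(2)
      by (simp add: numeral_eq_enat)
    then have "C4_free F" by (auto simp: C4_free_def)
    then show ?thesis using F subgraph_trans[OF F(1) H(1)] by blast
  qed
  with M show ?thesis by blast
qed

end
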